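(* For every $k\geq 2$, every Turing degree that computes a Schnorr random real is $k$-surviving. In particular, for every $k\geq 2$ there is a $k$-surviving degree that is DNC, and there is a $k$-surviving degree that is not computably traceable.
   Context: A tree is a subset of $(k+1)^{<\omega}$ closed under initial segments. A $k$-branching tree is a tree in which every node has either exactly $1$ or exactly $k$ immediate successors. A function $f\in (k+1)^\omega$ is $k$-surviving if it is not an infinite path through any computable $k$-branching subtree of $(k+1)^{<\omega}$; a Turing degree is $k$-surviving if it computes a $k$-surviving function. A degree is DNC if it computes a function $g$ with $g(e)\neq\varphi_e(e)$ whenever $\varphi_e(e)$ converges. A degree $\mathbf{a}$ is computably traceable if there is a computable $h:\omega\to\omega$ such that for every $f\in\omega^\omega$ computable from $\mathbf{a}$ there is a computable sequence of finite sets $(D_n)$ (given by canonical indices) with $|D_n|\leq h(n)$ and $f(n)\in D_n$ for all $n$. *)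

theory Defs
  imports "HOL-Probability.Probability" "HOL-Library.Nat_Bijection" "HOL-Library.Sublist"
begin

section \<open>Oracle computations\<close>

text \<open>The partial recursive functionals: \<open>computes A p xs y\<close> says that program \<open>p\<close>, with the
  characteristic function of \<open>A \<in> 2\<^sup>\<omega>\<close> as oracle, halts on input \<open>xs\<close> with output \<open>y\<close>.\<close>

datatype program =
    Zero
  | Successor
  | Proj nat
  | Oracle
  | Comp program "program list"
  | PrimRec program program
  | Mu program

inductive computes :: "(nat \<Rightarrow> bool) \<Rightarrow> program \<Rightarrow> nat list \<Rightarrow> nat \<Rightarrow> bool"
  for A :: "nat \<Rightarrow> bool" where
  Zero: "computes A Zero xs 0"
| Successor: "computes A Successor [x] (Suc x)"
| Proj: "i < length xs \<Longrightarrow> computes A (Proj i) xs (xs ! i)"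
| Oracle: "computes A Oracle [x] (of_bool (A x))"
| Comp: "list_all2 (\<lambda>g y. computes A g xs y) gs ys \<Longrightarrow> computes A f ys z
    \<Longrightarrow> computes A (Comp f gs) xs z"
| PrimRec_0: "computes A f xs y \<Longrightarrow> computes A (PrimRec f g) (0 # xs) y"
| PrimRec_Suc: "computes A (PrimRec f g) (n # xs) y \<Longrightarrow> computes A g (n # y # xs) z
    \<Longrightarrow> computes A (PrimRec f g) (Suc n # xs) z"
| Mu: "computes A f (n # xs) 0 \<Longrightarrow> \<forall>m<n. \<exists>y>0. computes A f (m # xs) y
    \<Longrightarrow> computes A (Mu f) xs n"

lemma computes_deterministic:
  "computes A p xs y \<Longrightarrow> computes A p xs z \<Longrightarrow> y = z"
proof (induction arbitrary: z rule: computes.induct)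
  case (Comp xs gs ys f w)
  from Comp.prems obtain ys' where
    ys': "list_all2 (\<lambda>g y. computes A g xs y) gs ys'" "computes A f ys' z"
    by (cases rule: computes.cases) auto
  have "ys = ys'"
    using Comp.IH(1) ys'(1)
    by (auto simp: list_all2_conv_all_nth intro!: nth_equalityI)
  then show ?case using Comp.IH ys'(2) by blast
next
  case (Mu f n xs)
  from Mu.prems have z: "computes A f (z # xs) 0" "\<forall>m<z. \<exists>y>0. computes A f (m # xs) y"
    by (cases rule: computes.cases; auto)+
  show ?case
  proof (rule linorder_cases[of n z])
    assume "n < z"
    with z(2) Mu.IH(1) show ?thesis by fastforce
  next
    assume "z < n"
    with z(1) Mu.IH(2) show ?thesis by fastforce
  qed
next
  case (PrimRec_0 f xs y g)
  from PrimRec_0.prems show ?case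
    by (cases rule: computes.cases) (auto intro: PrimRec_0.IH)
next
  case (PrimRec_Suc f g n xs y w)
  from PrimRec_Suc.prems obtain y' where
    "computes A (PrimRec f g) (n # xs) y'" "computes A g (n # y' # xs) z"
    by (cases rule: computes.cases) auto
  then show ?case using PrimRec_Suc.IH by blast
qed (auto elim: computes.cases)

definition computable_from :: "(nat \<Rightarrow> bool) \<Rightarrow> (nat \<Rightarrow> nat) \<Rightarrow> bool" where
  "computable_from A f \<longleftrightarrow> (\<exists>p. \<forall>x. computes A p [x] (f x))"

text \<open>Absolute computability is computability with the empty oracle.\<close>

abbreviation empty_oracle :: "nat \<Rightarrow> bool" where
  "empty_oracle \<equiv> \<lambda>_. False"

definition computable :: "(nat \<Rightarrow> nat) \<Rightarrow> bool" where
  "computable f \<longleftrightarrow> computable_from empty_oracle f"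

definition computable2 :: "(nat \<Rightarrow> nat \<Rightarrow> nat) \<Rightarrow> bool" where
  "computable2 f \<longleftrightarrow> (\<exists>p. \<forall>x y. computes empty_oracle p [x, y] (f x y))"

definition computable_set :: "nat set \<Rightarrow> bool" where
  "computable_set S \<longleftrightarrow> computable (\<lambda>x. of_bool (x \<in> S))"

text \<open>An effective numbering \<open>\<phi>\<close> of the unary partial computable functions; numbers that are not
  codes of programs index the nowhere defined function. \<open>\<phi> e x y\<close> means that \<open>\<phi>\<^sub>e(x)\<close> converges
  to \<open>y\<close>.\<close>

primrec program_encode :: "program \<Rightarrow> nat" where
  "program_encode Zero = prod_encode (0, 0)"
| "program_encode Successor = prod_encode (1, 0)"
| "program_encode (Proj i) = prod_encode (2, i)"
| "program_encode Oracle = prod_encode (3, 0)"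
| "program_encode (Comp f gs) =
    prod_encode (4, prod_encode (program_encode f, list_encode (map program_encode gs)))"
| "program_encode (PrimRec f g) =
    prod_encode (5, prod_encode (program_encode f, program_encode g))"
| "program_encode (Mu f) = prod_encode (6, program_encode f)"

lemma program_encode_inject: "program_encode p = program_encode q \<Longrightarrow> p = q"
proof (induction p arbitrary: q)
  case (Comp f gs)
  from Comp.prems obtain f' gs' where q: "q = Comp f' gs'"
    by (cases q) auto
  with Comp.prems have "program_encode f = program_encode f'"
    and map_eq: "map program_encode gs = map program_encode gs'"
    by (auto dest: inj_onD[OF inj_list_encode])
  moreover have "gs = gs'"
    by (rule nth_equalityI)
      (use map_eq Comp.IH(2) in \<open>metis length_map\<close>,
       metis map_eq Comp.IH(2) length_map nth_map nth_mem)
  ultimately show ?case using Comp.IH(1) q by blast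
next
  case (PrimRec f g) then show ?case by (cases q) auto
next
  case (Mu f) then show ?case by (cases q) auto
next
  case Zero then show ?case by (cases q) auto
next
  case Successor then show ?case by (cases q) auto
next
  case (Proj i) then show ?case by (cases q) auto
next
  case Oracle then show ?case by (cases q) auto
qed

definition phi :: "nat \<Rightarrow> nat \<Rightarrow> nat \<Rightarrow> bool" (\<open>\<phi>\<close>) where
  "\<phi> e x y \<longleftrightarrow> (\<exists>p. program_encode p = e \<and> computes empty_oracle p [x] y)"


section \<open>Turing degrees\<close>

definition turing_le :: "(nat \<Rightarrow> bool) \<Rightarrow> (nat \<Rightarrow> bool) \<Rightarrow> bool" where
  "turing_le A B \<longleftrightarrow> computable_from B (\<lambda>x. of_bool (A x))"

definition turing_equiv :: "(nat \<Rightarrow> bool) \<Rightarrow> (nat \<Rightarrow> bool) \<Rightarrow> bool" where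
  "turing_equiv A B \<longleftrightarrow> turing_le A B \<and> turing_le B A"

primrec oracle_subst :: "program \<Rightarrow> program \<Rightarrow> program" where
  "oracle_subst q Zero = Zero"
| "oracle_subst q Successor = Successor"
| "oracle_subst q (Proj i) = Proj i"
| "oracle_subst q Oracle = q"
| "oracle_subst q (Comp f gs) = Comp (oracle_subst q f) (map (oracle_subst q) gs)"
| "oracle_subst q (PrimRec f g) = PrimRec (oracle_subst q f) (oracle_subst q g)"
| "oracle_subst q (Mu f) = Mu (oracle_subst q f)"

lemma computes_oracle_subst:
  assumes q: "\<And>x. computes B q [x] (of_bool (A x))"
  shows "computes A p xs y \<Longrightarrow> computes B (oracle_subst q p) xs y"
proof (induction rule: computes.induct)
  case (Comp xs gs ys f z)
  then have "list_all2 (\<lambda>g y. computes B g xs y) (map (oracle_subst q) gs) ys"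
    by (auto simp: list_all2_conv_all_nth)
  with Comp show ?case by (auto intro: computes.Comp)
next
  case (Mu f n xs)
  then show ?case by (auto intro!: computes.Mu)
next
  case (Oracle x)
  show ?case using q[of x] by simp
qed (auto intro: computes.intros)

lemma computable_from_trans:
  "computable_from A f \<Longrightarrow> turing_le A B \<Longrightarrow> computable_from B f"
  unfolding computable_from_def turing_le_def by (meson computes_oracle_subst)

lemma turing_le_refl: "turing_le A A"
  unfolding computable_from_def turing_le_def by (meson computes.Oracle)

lemma turing_le_trans: "turing_le A B \<Longrightarrow> turing_le B C \<Longrightarrow> turing_le A C"
  using computable_from_trans turing_le_def by blast

quotient_type turing_degree = "nat \<Rightarrow> bool" / turing_equiv
  by (rule equivpI)
    (auto simp: reflp_def symp_def transp_def turing_equiv_def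
      intro: turing_le_refl turing_le_trans)

lift_definition deg_computes :: "turing_degree \<Rightarrow> (nat \<Rightarrow> nat) \<Rightarrow> bool" is computable_from
  unfolding turing_equiv_def fun_eq_iff using computable_from_trans by blast


section \<open>Surviving, DNC and computably traceable degrees\<close>

definition is_tree :: "nat \<Rightarrow> nat list set \<Rightarrow> bool" where
  "is_tree k T \<longleftrightarrow> (\<forall>\<sigma>\<in>T. set \<sigma> \<subseteq> {..<k + 1}) \<and> (\<forall>\<tau>\<in>T. \<forall>\<sigma>. prefix \<sigma> \<tau> \<longrightarrow> \<sigma> \<in> T)"

definition immediate_succs :: "nat list set \<Rightarrow> nat list \<Rightarrow> nat list set" where
  "immediate_succs T \<sigma> = {\<tau> \<in> T. \<exists>i. \<tau> = \<sigma> @ [i]}"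

definition k_branching :: "nat \<Rightarrow> nat list set \<Rightarrow> bool" where
  "k_branching k T \<longleftrightarrow> is_tree k T \<and>
    (\<forall>\<sigma>\<in>T. card (immediate_succs T \<sigma>) = 1 \<or> card (immediate_succs T \<sigma>) = k)"

definition computable_tree :: "nat list set \<Rightarrow> bool" where
  "computable_tree T \<longleftrightarrow> computable_set (list_encode ` T)"

definition is_path :: "(nat \<Rightarrow> nat) \<Rightarrow> nat list set \<Rightarrow> bool" where
  "is_path f T \<longleftrightarrow> (\<forall>n. map f [0..<n] \<in> T)"

definition surviving_fun :: "nat \<Rightarrow> (nat \<Rightarrow> nat) \<Rightarrow> bool" where
  "surviving_fun k f \<longleftrightarrow> (\<forall>n. f n < k + 1) \<and>
    \<not> (\<exists>T. k_branching k T \<and> computable_tree T \<and> is_path f T)"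

definition surviving :: "nat \<Rightarrow> turing_degree \<Rightarrow> bool" where
  "surviving k a \<longleftrightarrow> (\<exists>f. deg_computes a f \<and> surviving_fun k f)"

definition DNC :: "turing_degree \<Rightarrow> bool" where
  "DNC a \<longleftrightarrow> (\<exists>g. deg_computes a g \<and> (\<forall>e y. \<phi> e e y \<longrightarrow> g e \<noteq> y))"

text \<open>\<^const>\<open>set_decode\<close> is the canonical indexing of finite sets of natural numbers:
  \<open>set_decode (2\<^sup>a + 2\<^sup>b + \<dots>) = {a, b, \<dots>}\<close> for distinct \<open>a, b, \<dots>\<close>\<close>

definition computably_traceable :: "turing_degree \<Rightarrow> bool" where
  "computably_traceable a \<longleftrightarrow> (\<exists>h. computable h \<and>
    (\<forall>f. deg_computes a f \<longrightarrow>
      (\<exists>d. computable d \<and> (\<forall>n. card (set_decode (d n)) \<le> h n \<and> f n \<in> set_decode (d n)))))"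


section \<open>Schnorr randomness\<close>

text \<open>Reals are elements of Cantor space \<open>2\<^sup>\<omega>\<close>, with the uniform (fair coin) measure.\<close>

definition cantor_measure :: "(nat \<Rightarrow> bool) measure" where
  "cantor_measure = PiM UNIV (\<lambda>_. measure_pmf (bernoulli_pmf (1/2)))"

definition cylinder :: "bool list \<Rightarrow> (nat \<Rightarrow> bool) set" where
  "cylinder \<sigma> = {X. \<forall>i<length \<sigma>. X i = \<sigma> ! i}"

definition open_of :: "bool list set \<Rightarrow> (nat \<Rightarrow> bool) set" where
  "open_of W = (\<Union>\<sigma>\<in>W. cylinder \<sigma>)"

text \<open>Uniformly c.e.: the relation \<open>\<sigma> \<in> W n\<close> is the domain of a partial computable function.\<close>

definition uniformly_ce :: "(nat \<Rightarrow> bool list set) \<Rightarrow> bool" where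
  "uniformly_ce W \<longleftrightarrow>
    (\<exists>p. \<forall>n \<sigma>. \<sigma> \<in> W n \<longleftrightarrow> (\<exists>y. computes empty_oracle p [n, list_encode (map of_bool \<sigma>)] y))"

text \<open>Uniformly computable reals: rational approximations \<open>(a - b) / (c + 1)\<close> of precision \<open>2\<^sup>-\<^sup>i\<close>
  can be computed from \<open>n\<close> and \<open>i\<close>.\<close>

definition uniformly_computable_reals :: "(nat \<Rightarrow> real) \<Rightarrow> bool" where
  "uniformly_computable_reals r \<longleftrightarrow> (\<exists>a b c. computable2 a \<and> computable2 b \<and> computable2 c \<and>
    (\<forall>n i. \<bar>r n - (real (a n i) - real (b n i)) / real (c n i + 1)\<bar> \<le> 1 / 2 ^ i))"

definition schnorr_test :: "(nat \<Rightarrow> (nat \<Rightarrow> bool) set) \<Rightarrow> bool" where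
  "schnorr_test U \<longleftrightarrow>
    (\<exists>W. uniformly_ce W \<and> (\<forall>n. U n = open_of (W n))) \<and>
    (\<forall>n. measure cantor_measure (U n) \<le> 1 / 2 ^ n) \<and>
    uniformly_computable_reals (\<lambda>n. measure cantor_measure (U n))"

definition schnorr_random :: "(nat \<Rightarrow> bool) \<Rightarrow> bool" where
  "schnorr_random X \<longleftrightarrow> (\<forall>U. schnorr_test U \<longrightarrow> X \<notin> (\<Inter>n. U n))"

text \<open>A degree computes a real if it computes its characteristic function.\<close>

definition deg_computes_real :: "turing_degree \<Rightarrow> (nat \<Rightarrow> bool) \<Rightarrow> bool" where
  "deg_computes_real a X \<longleftrightarrow> deg_computes a (\<lambda>n. of_bool (X n))"

end

theory Submission
  imports Defs
begin

text \<open>Cut a real \<open>X\<close> into blocks of \<open>k\<close> bits and let \<open>f(n) \<le> k\<close> be the number of ones in the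
  \<open>n\<close>-th block. Every value in \<open>{0, \<dots>, k}\<close> occurs with probability at least \<open>2\<^sup>-\<^sup>k\<close>, and a
  \<open>k\<close>-branching tree omits at least one of the \<open>k + 1\<close> possible successors of each node, so the
  \<open>X\<close> for which \<open>f\<close> stays in the tree up to level \<open>m\<close> have measure at most \<open>(1 - 2\<^sup>-\<^sup>k)\<^sup>m\<close>. For a
  computable tree these clopen sets form a Schnorr test (along \<open>m = c n\<close>), so \<open>f\<close> is
  \<open>k\<close>-surviving if \<open>X\<close> is Schnorr random. The existence statements do not need randomness: there are
  only countably many computable objects, so one diagonalises against all of them and takes the
  degree of an oracle coding the two functions obtained.\<close>

section \<open>Total computable functions\<close>

text \<open>All arguments come in one list of fixed length \<open>m\<close>, so that a function of
  several variables is a plain term in \<open>xs ! i\<close> and its computability follows by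
  backward chaining through closure rules. Lists of other lengths are unconstrained.\<close>

definition computable_on :: "(nat \<Rightarrow> bool) \<Rightarrow> nat \<Rightarrow> (nat list \<Rightarrow> nat) \<Rightarrow> bool" where
  "computable_on A m f \<longleftrightarrow> (\<exists>p. \<forall>xs. length xs = m \<longrightarrow> computes A p xs (f xs))"

lemma computable_on_cong:
  "(\<And>xs. length xs = m \<Longrightarrow> f xs = g xs) \<Longrightarrow> computable_on A m f \<longleftrightarrow> computable_on A m g"
  by (auto simp: computable_on_def)

lemma computable_on_nth: "i < m \<Longrightarrow> computable_on A m (\<lambda>xs. xs ! i)"
  unfolding computable_on_def using computes.Proj by (metis (lifting))

text \<open>Sums and recursions put their own variables in front of the parameters, which then
  appear as a tail of the argument list. This rule and the next read them off there.\<close>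

lemma computable_on_nth_tl: "Suc i < m \<Longrightarrow> computable_on A m (\<lambda>xs. tl xs ! i)"
  using computable_on_nth[of "Suc i" m A]
  by (rule iffD1[OF computable_on_cong, rotated]) (auto simp: nth_tl)

lemma computable_on_nth_tl_tl: "Suc (Suc i) < m \<Longrightarrow> computable_on A m (\<lambda>xs. tl (tl xs) ! i)"
  using computable_on_nth[of "Suc (Suc i)" m A]
  by (rule iffD1[OF computable_on_cong, rotated]) (auto simp: nth_tl)

lemma computable_on_compose:
  assumes "computable_on A (length fs) g" and "\<And>f. f \<in> set fs \<Longrightarrow> computable_on A m f"
  shows "computable_on A m (\<lambda>xs. g (map (\<lambda>f. f xs) fs))"
proof -
  obtain p where p: "\<And>ys. length ys = length fs \<Longrightarrow> computes A p ys (g ys)"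
    using assms(1) by (auto simp: computable_on_def)
  obtain q where q: "\<And>f xs. f \<in> set fs \<Longrightarrow> length xs = m \<Longrightarrow> computes A (q f) xs (f xs)"
    using assms(2) unfolding computable_on_def by metis
  have "computes A (Comp p (map q fs)) xs (g (map (\<lambda>f. f xs) fs))" if "length xs = m" for xs
    by (rule computes.Comp[OF _ p]) (auto simp: list_all2_conv_all_nth q that)
  then show ?thesis by (auto simp: computable_on_def)
qed

lemma computable_on_compose1:
  assumes "computable_on A (Suc 0) (\<lambda>xs. g (xs ! 0))" and "computable_on A m f"
  shows "computable_on A m (\<lambda>xs. g (f xs))"
  using computable_on_compose[of A "[f]" "\<lambda>xs. g (xs ! 0)" m] assms by simp

lemma computable_on_compose2:
  assumes "computable_on A 2 (\<lambda>xs. g (xs ! 0) (xs ! 1))"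
    and "computable_on A m f" "computable_on A m f'"
  shows "computable_on A m (\<lambda>xs. g (f xs) (f' xs))"
  using computable_on_compose[of A "[f, f']" "\<lambda>xs. g (xs ! 0) (xs ! 1)" m] assms
  by (auto simp: numeral_2_eq_2)

lemma length_Suc_0_nth: "length xs = Suc 0 \<Longrightarrow> xs = [xs ! 0]"
  by (auto simp: length_Suc_conv)

lemma computable_on_Suc_0_iff: "computable_on A (Suc 0) (\<lambda>xs. f (xs ! 0)) \<longleftrightarrow> computable_from A f"
proof -
  have "(\<forall>xs. length xs = Suc 0 \<longrightarrow> computes A p xs (f (xs ! 0))) \<longleftrightarrow> (\<forall>x. computes A p [x] (f x))"
    for p
    by (metis length_Cons length_Suc_0_nth list.size(3) nth_Cons_0)
  then show ?thesis
    by (simp add: computable_on_def computable_from_def)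
qed

lemma computable2I:
  "computable_on empty_oracle 2 (\<lambda>xs. f (xs ! 0) (xs ! 1)) \<Longrightarrow> computable2 f"
  unfolding computable_on_def computable2_def
  by (metis (lifting) One_nat_def length_Cons list.size(3) nth_Cons_0 nth_Cons_Suc numeral_2_eq_2)

lemma computable_on_oracle: "computable_on A m f \<Longrightarrow> computable_on A m (\<lambda>xs. of_bool (A (f xs)))"
proof (rule computable_on_compose1[where g = "\<lambda>x. of_bool (A x)"])
  show "computable_on A (Suc 0) (\<lambda>xs. of_bool (A (xs ! 0)))"
    using computes.Oracle
    by (subst computable_on_Suc_0_iff[where f = "\<lambda>x. of_bool (A x)"],
        unfold computable_from_def) blast
qed

lemma computable_on_Suc: "computable_on A m f \<Longrightarrow> computable_on A m (\<lambda>xs. Suc (f xs))"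
  by (rule computable_on_compose1[where g = Suc])
    (auto simp: computable_on_Suc_0_iff computable_from_def intro: computes.Successor)

lemma computable_on_const: "computable_on A m (\<lambda>xs. c)"
proof (induction c)
  case 0
  show ?case by (auto simp: computable_on_def intro: computes.Zero)
next
  case (Suc c)
  then show ?case by (rule computable_on_Suc)
qed

lemma computable_on_rec_nat:
  assumes "computable_on A m f"
    and "computable_on A (Suc (Suc m)) (\<lambda>ys. g (ys ! 0) (ys ! 1) (tl (tl ys)))"
    and "computable_on A m N"
  shows "computable_on A m (\<lambda>xs. rec_nat (f xs) (\<lambda>i y. g i y xs) (N xs))"
proof -
  obtain p where p: "\<And>xs. length xs = m \<Longrightarrow> computes A p xs (f xs)"
    using assms(1) by (auto simp: computable_on_def)
  obtain q where q: "\<And>ys. length ys = Suc (Suc m) \<Longrightarrow>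
      computes A q ys (g (ys ! 0) (ys ! 1) (tl (tl ys)))"
    using assms(2) by (auto simp: computable_on_def)
  obtain r where r: "\<And>xs. length xs = m \<Longrightarrow> computes A r xs (N xs)"
    using assms(3) by (auto simp: computable_on_def)
  have rec: "computes A (PrimRec p q) (n # xs) (rec_nat (f xs) (\<lambda>i y. g i y xs) n)"
    if "length xs = m" for n xs
  proof (induction n)
    case 0
    then show ?case using p[OF that] by (auto intro: computes.PrimRec_0)
  next
    case (Suc n)
    show ?case
      using computes.PrimRec_Suc[OF Suc] q[of "n # rec_nat (f xs) (\<lambda>i y. g i y xs) n # xs"] that
      by simp
  qed
  \<comment> \<open>\<open>PrimRec\<close> recurses on its first argument, so the value of
    \<open>N\<close> is put in front and the projections repeat the parameters behind it.\<close>
  have "computes A (Comp (PrimRec p q) (r # map Proj [0..<m])) xs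
      (rec_nat (f xs) (\<lambda>i y. g i y xs) (N xs))" if "length xs = m" for xs
    using that
    by (intro computes.Comp[OF _ rec])
      (auto simp: list_all2_conv_all_nth nth_Cons r intro: computes.Proj split: nat.split)
  then show ?thesis by (auto simp: computable_on_def)
qed

lemmas computable_on_base =
  computable_on_nth computable_on_nth_tl computable_on_nth_tl_tl computable_on_const
  computable_on_Suc

section \<open>Closure under arithmetic, bounded sums and binary digits\<close>

lemma computable_on_add:
  assumes "computable_on A m f" "computable_on A m g"
  shows "computable_on A m (\<lambda>xs. f xs + g xs)"
proof -
  have "rec_nat x (\<lambda>_ y. Suc y) n = x + n" for x n by (induction n) auto
  with computable_on_rec_nat[of A m f "\<lambda>_ y _. Suc y" g] assms show ?thesis
    by (simp add: computable_on_base)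
qed

lemma computable_on_sum:
  assumes "computable_on A (Suc m) (\<lambda>ys. g (ys ! 0) (tl ys))" and "computable_on A m N"
  shows "computable_on A m (\<lambda>xs. \<Sum>i<N xs. g i xs)"
proof -
  have rec: "rec_nat 0 (\<lambda>i y. y + g i xs) n = (\<Sum>i<n. g i xs)" for n xs by (induction n) auto
  have "computable_on A (Suc (Suc m)) (\<lambda>ys. g (ys ! 0) (tl (tl ys)))"
  proof -
    \<comment> \<open>The recursion step sees \<open>i # y # xs\<close> while the summand expects
      \<open>i # xs\<close>; these projections drop the accumulator \<open>y\<close>.\<close>
    let ?fs = "(\<lambda>ys. ys ! 0) # map (\<lambda>i ys. ys ! Suc (Suc i)) [0..<m]"
    have "computable_on A (Suc (Suc m))
        (\<lambda>ys. (\<lambda>ys. g (ys ! 0) (tl ys)) (map (\<lambda>f. f ys) ?fs))"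
      by (rule computable_on_compose) (use assms(1) in \<open>auto intro: computable_on_nth\<close>)
    also have "?this \<longleftrightarrow> ?thesis"
    proof (rule computable_on_cong)
      fix ys :: "nat list"
      assume ys: "length ys = Suc (Suc m)"
      have "tl (tl ys) = map (\<lambda>i. ys ! Suc (Suc i)) [0..<m]"
        by (rule nth_equalityI) (use ys in \<open>auto simp: nth_tl\<close>)
      then show "(\<lambda>ys. g (ys ! 0) (tl ys)) (map (\<lambda>f. f ys) ?fs) = g (ys ! 0) (tl (tl ys))"
        by (simp add: comp_def)
    qed
    finally show ?thesis .
  qed
  then have "computable_on A m (\<lambda>xs. rec_nat 0 (\<lambda>i y. y + g i xs) (N xs))"
    by (intro computable_on_rec_nat[where f = "\<lambda>_. 0" and g = "\<lambda>i y xs. y + g i xs"]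
        computable_on_add computable_on_base assms) auto
  then show ?thesis by (simp add: rec)
qed

lemma computable_on_mult:
  assumes "computable_on A m f" "computable_on A m g"
  shows "computable_on A m (\<lambda>xs. f xs * g xs)"
proof (rule computable_on_compose2[where g = "(*)"])
  have "computable_on A 2 (\<lambda>xs. \<Sum>i<xs ! 1. xs ! 0)"
    by (rule computable_on_sum) (auto intro: computable_on_base)
  then show "computable_on A 2 (\<lambda>xs. xs ! 0 * xs ! 1)"
    by (simp add: mult.commute)
qed fact+

lemma computable_on_diff:
  assumes "computable_on A m f" "computable_on A m g"
  shows "computable_on A m (\<lambda>xs. f xs - g xs)"
proof -
  have pred: "computable_on A m (\<lambda>xs. f xs - 1)" if "computable_on A m f" for m f
  proof -
    have "rec_nat 0 (\<lambda>i _. i) n = n - 1" for n by (cases n) auto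
    with computable_on_rec_nat[of A m "\<lambda>_. 0" "\<lambda>i _ _. i" f] that show ?thesis
      by (simp add: computable_on_base)
  qed
  have "rec_nat x (\<lambda>_ y. y - 1) n = x - n" for x n by (induction n) auto
  with computable_on_rec_nat[of A m f "\<lambda>_ y _. y - 1" g] assms show ?thesis
    by (simp add: computable_on_base pred[simplified])
qed

lemma computable_on_power:
  assumes "computable_on A m f" "computable_on A m g"
  shows "computable_on A m (\<lambda>xs. f xs ^ g xs)"
proof (rule computable_on_compose2[where g = "(^)"])
  have "rec_nat 1 (\<lambda>_ y. y * x) n = x ^ n" for x n :: nat by (induction n) auto
  moreover have "computable_on A 2 (\<lambda>xs. rec_nat 1 (\<lambda>_ y. y * xs ! 0) (xs ! 1))"
    by (rule computable_on_rec_nat) (auto intro!: computable_on_mult computable_on_base)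
  ultimately show "computable_on A 2 (\<lambda>xs. xs ! 0 ^ xs ! 1)"
    by simp
qed fact+

lemma computable_on_eq:
  assumes "computable_on A m f" "computable_on A m g"
  shows "computable_on A m (\<lambda>xs. of_bool (f xs = g xs))"
proof -
  have "of_bool (f xs = g xs) = 1 - ((f xs - g xs) + (g xs - f xs))" for xs
    by auto
  then show ?thesis
    by (simp only:) (intro computable_on_diff computable_on_add computable_on_base assms)
qed

lemma computable_on_mod2:
  assumes "computable_on A m f"
  shows "computable_on A m (\<lambda>xs. f xs mod 2)"
proof -
  have "rec_nat 0 (\<lambda>_ y. 1 - y) n = n mod 2" for n :: nat
    by (induction n) (auto simp: mod_Suc)
  with computable_on_rec_nat[of A m "\<lambda>_. 0" "\<lambda>_ y _. 1 - y" f] assms show ?thesis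
    by (simp add: computable_on_base computable_on_diff)
qed

lemma computable_on_div2:
  assumes "computable_on A m f"
  shows "computable_on A m (\<lambda>xs. f xs div 2)"
proof -
  have "rec_nat 0 (\<lambda>i y. y + i mod 2) n = n div 2" for n :: nat
    by (induction n) (auto, presburger)
  with computable_on_rec_nat[of A m "\<lambda>_. 0" "\<lambda>i y _. y + i mod 2" f] assms show ?thesis
    by (simp add: computable_on_base computable_on_add computable_on_mod2)
qed

lemma computable_on_bit:
  assumes "computable_on A m f" "computable_on A m g"
  shows "computable_on A m (\<lambda>xs. of_bool (bit (f xs) (g xs)))"
proof -
  have "rec_nat x (\<lambda>_ y. y div 2) n = x div 2 ^ n" for x n :: nat
    by (induction n) (auto simp: div_mult2_eq[symmetric] mult.commute)
  with computable_on_rec_nat[of A m f "\<lambda>_ y _. y div 2" g] assms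
  have "computable_on A m (\<lambda>xs. f xs div 2 ^ g xs)"
    by (simp add: computable_on_base computable_on_div2)
  moreover have "of_bool (bit (f xs) (g xs)) = f xs div 2 ^ g xs mod 2" for xs
    by (simp add: bit_iff_odd mod2_eq_if)
  ultimately show ?thesis
    by (simp only: computable_on_mod2)
qed

section \<open>Codes of pairs and lists\<close>

lemma computable_on_prod_encode:
  assumes "computable_on A m f" "computable_on A m g"
  shows "computable_on A m (\<lambda>xs. prod_encode (f xs, g xs))"
  unfolding prod_encode_def triangle_def prod.case
  by (intro computable_on_add computable_on_div2 computable_on_mult computable_on_base assms)

lemma computable_on_list_encode:
  assumes "computable_on A 2 (\<lambda>xs. g (xs ! 0) (xs ! 1))"
    and "computable_on A m N" "computable_on A m f"
  shows "computable_on A m (\<lambda>xs. list_encode (map (g (f xs)) [0..<N xs]))"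
proof (rule computable_on_compose2[where g = "\<lambda>n x. list_encode (map (g x) [0..<n])", OF _ assms(2,3)])
  \<comment> \<open>\<open>list_encode\<close> wraps the head around the code of the tail, so the
    code is built from the last entry backwards: stage \<open>i\<close> prepends the entry with
    index \<open>xs ! 0 - Suc i\<close>.\<close>
  define step where
    "step i y xs = Suc (prod_encode (g (xs ! 1) (xs ! 0 - Suc i), y))" for i y xs
  have rec: "rec_nat 0 (\<lambda>i y. step i y xs) i = list_encode (map (g (xs ! 1)) [xs ! 0 - i..<xs ! 0])"
    if "i \<le> xs ! 0" for i xs
    using that
  proof (induction i)
    case (Suc i)
    then have "xs ! 0 - i = Suc (xs ! 0 - Suc i)" by auto
    moreover have "[xs ! 0 - Suc i..<xs ! 0] = (xs ! 0 - Suc i) # [Suc (xs ! 0 - Suc i)..<xs ! 0]"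
      by (rule upt_conv_Cons) (use Suc.prems in auto)
    ultimately show ?case using Suc by (simp add: step_def)
  qed simp
  have "computable_on A 2 (\<lambda>xs. rec_nat 0 (\<lambda>i y. step i y xs) (xs ! 0))"
    unfolding step_def
    by (rule computable_on_rec_nat)
      (auto intro!: computable_on_prod_encode computable_on_diff computable_on_base
        computable_on_compose2[OF assms(1)])
  then show "computable_on A 2 (\<lambda>xs. list_encode (map (g (xs ! 1)) [0..<xs ! 0]))"
    by (simp add: rec)
qed

section \<open>Unbounded search\<close>

lemma computes_Mu:
  assumes "\<And>ys. length ys = Suc m \<Longrightarrow> computes A p ys (f ys)" and xs: "length xs = m"
  shows "computes A (Mu p) xs y \<longleftrightarrow> f (y # xs) = 0 \<and> (\<forall>i<y. f (i # xs) > 0)"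
proof
  have p: "computes A p (i # xs) z \<longleftrightarrow> z = f (i # xs)" for i z
    using assms computes_deterministic by (metis length_Cons)
  show "f (y # xs) = 0 \<and> (\<forall>i<y. f (i # xs) > 0)" if "computes A (Mu p) xs y"
    using that by (cases rule: computes.cases) (auto simp: p)
  show "computes A (Mu p) xs y" if "f (y # xs) = 0 \<and> (\<forall>i<y. f (i # xs) > 0)"
    using that by (auto intro!: computes.Mu simp: p)
qed

text \<open>Searching through all \<open>i\<close> in order halts exactly if some \<open>i\<close>
  works, because every single check terminates. This turns an existential condition into the domain
  of a program, the form that \<open>uniformly_ce\<close> asks for.\<close>

lemma computable_on_Mu:
  assumes "computable_on A (Suc m) f"
  obtains p where "\<And>xs. length xs = m \<Longrightarrow> (\<exists>y. computes A p xs y) \<longleftrightarrow> (\<exists>i. f (i # xs) = 0)"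
proof -
  obtain p where p: "\<And>ys. length ys = Suc m \<Longrightarrow> computes A p ys (f ys)"
    using assms by (auto simp: computable_on_def)
  have "(\<exists>y. computes A (Mu p) xs y) \<longleftrightarrow> (\<exists>i. f (i # xs) = 0)" if "length xs = m" for xs
    using computes_Mu[OF p that] exists_least_iff[of "\<lambda>i. f (i # xs) = 0"] by (metis neq0_conv)
  with that show ?thesis by blast
qed


section \<open>Clopen sets of Cantor space\<close>

text \<open>A cylinder restricts finitely many coordinates to one value each, so it is a basic
  product set, and every restricted coordinate contributes a factor 1/2.\<close>

lemma sets_cylinder: "cylinder \<sigma> \<in> sets cantor_measure"
  and measure_cylinder: "measure cantor_measure (cylinder \<sigma>) = 1 / 2 ^ length \<sigma>"
proof -
  interpret product_prob_space "\<lambda>_. measure_pmf (bernoulli_pmf (1/2))" "UNIV :: nat set"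
    by (intro product_prob_spaceI) (simp add: measure_pmf.prob_space_axioms)
  have eq: "cylinder \<sigma> = prod_emb UNIV (\<lambda>_. measure_pmf (bernoulli_pmf (1/2))) {..<length \<sigma>}
      (\<Pi>\<^sub>E i\<in>{..<length \<sigma>}. {\<sigma> ! i})"
    by (auto simp: cylinder_def prod_emb_def PiE_iff restrict_def)
  show "cylinder \<sigma> \<in> sets cantor_measure"
    unfolding eq cantor_measure_def by (rule sets_PiM_I) auto
  have "measure cantor_measure (cylinder \<sigma>)
      = (\<Prod>i<length \<sigma>. measure (measure_pmf (bernoulli_pmf (1/2))) {\<sigma> ! i})"
    unfolding eq cantor_measure_def by (rule measure_PiM_emb) auto
  also have "\<dots> = (\<Prod>i<length \<sigma>. 1 / 2)"
    by (rule prod.cong) (auto simp: measure_pmf_single pmf_bernoulli_half)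
  finally show "measure cantor_measure (cylinder \<sigma>) = 1 / 2 ^ length \<sigma>"
    by (simp add: power_one_over)
qed

text \<open>Distinct strings of one common length differ at some position, so their cylinders are
  disjoint and the masses add up.\<close>

lemma measure_open_of:
  assumes "W \<subseteq> {\<sigma>. length \<sigma> = n}"
  shows "measure cantor_measure (open_of W) = real (card W) / 2 ^ n"
proof -
  interpret prob_space cantor_measure
    unfolding cantor_measure_def by (intro prob_space_PiM measure_pmf.prob_space_axioms)
  have "finite W"
    using finite_subset[OF assms] finite_lists_length_eq[of "UNIV :: bool set" n] by simp
  moreover have "disjoint_family_on cylinder W"
  proof (unfold disjoint_family_on_def, intro ballI impI)
    fix \<sigma> \<tau> assume "\<sigma> \<in> W" "\<tau> \<in> W" "\<sigma> \<noteq> \<tau>"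
    then obtain i where "i < n" "\<sigma> ! i \<noteq> \<tau> ! i" "length \<sigma> = n" "length \<tau> = n"
      using assms nth_equalityI[of \<sigma> \<tau>] by auto
    then show "cylinder \<sigma> \<inter> cylinder \<tau> = {}"
      by (auto simp: cylinder_def)
  qed
  ultimately have "measure cantor_measure (open_of W) = (\<Sum>\<sigma>\<in>W. measure cantor_measure (cylinder \<sigma>))"
    unfolding open_of_def by (intro finite_measure_finite_Union) (auto intro: sets_cylinder)
  also have "\<dots> = (\<Sum>\<sigma>\<in>W. 1 / 2 ^ n)"
    using assms by (intro sum.cong) (auto simp: measure_cylinder)
  finally show ?thesis by simp
qed

section \<open>Block counts along branching trees\<close>

text \<open>Otherwise \<sigma> would be a node, as an initial segment of one, with
  \<open>k + 1\<close> immediate successors; this is neither \<open>k\<close> nor, since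
  \<open>k\<close> is positive, 1.\<close>

lemma k_branching_omits:
  assumes "k \<ge> 1" and T: "k_branching k T"
  shows "\<exists>i\<le>k. \<sigma> @ [i] \<notin> T"
proof (rule ccontr)
  assume "\<not> ?thesis"
  then have all: "\<And>i. i \<le> k \<Longrightarrow> \<sigma> @ [i] \<in> T" by auto
  with T have "\<sigma> \<in> T"
    unfolding k_branching_def is_tree_def by (meson le0 prefixI)
  have "immediate_succs T \<sigma> = (\<lambda>i. \<sigma> @ [i]) ` {..k}"
    using all T by (fastforce simp: immediate_succs_def k_branching_def is_tree_def)
  moreover have "card ((\<lambda>i. \<sigma> @ [i]) ` {..k}) = Suc k"
    by (subst card_image) (auto simp: inj_on_def)
  ultimately show False
    using T \<open>\<sigma> \<in> T\<close> \<open>k \<ge> 1\<close> by (auto simp: k_branching_def)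
qed

definition block_count :: "nat \<Rightarrow> (nat \<Rightarrow> bool) \<Rightarrow> nat \<Rightarrow> nat" where
  "block_count k X n = (\<Sum>i<k. of_bool (X (k * n + i)))"

lemma block_count_le: "block_count k X n \<le> k"
  unfolding block_count_def
  using sum_bounded_above[of "{..<k}" "\<lambda>i. of_bool (X (k * n + i)) :: nat" 1] by simp

text \<open>The first \<open>m\<close> blocks lie below position \<open>k * m\<close>. This allows
  switching between a real, a finite string used as a real, and the binary digits of a
  number.\<close>

lemma map_block_count_cong:
  assumes "\<And>i. i < k * m \<Longrightarrow> X i = Y i"
  shows "map (block_count k X) [0..<m] = map (block_count k Y) [0..<m]"
proof -
  have "k * n + i < k * m" if "i < k" "n < m" for i n
  proof -
    have "k * n + i < k * Suc n" using that by simp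
    also have "\<dots> \<le> k * m" using that by (intro mult_le_mono) auto
    finally show ?thesis .
  qed
  then show ?thesis
    by (auto simp: block_count_def assms intro!: sum.cong)
qed

text \<open>These strings generate the clopen set of reals whose first \<open>m\<close> block counts
  form a node of \<open>T\<close>. Having one common length makes the measure a matter of counting;
  \<open>(!) \<sigma>\<close> is evaluated only below the length of \<sigma>.\<close>

definition block_level :: "nat \<Rightarrow> nat list set \<Rightarrow> nat \<Rightarrow> bool list set" where
  "block_level k T m = {\<sigma>. length \<sigma> = k * m \<and> map (block_count k ((!) \<sigma>)) [0..<m] \<in> T}"

lemma finite_block_level: "finite (block_level k T m)"
  using finite_lists_length_eq[of "UNIV :: bool set" "k * m"]
  by (rule rev_finite_subset) (auto simp: block_level_def)

text \<open>A string of level \<open>m + 1\<close> is a string \<tau> of level \<open>m\<close>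
  followed by one block. The tree omits some count after \<tau>, which excludes at least one of the
  \<open>2 ^ k\<close> blocks, so each level adds a factor of at most
  \<open>2 ^ k - 1\<close>.\<close>

lemma card_block_level_le:
  assumes "k \<ge> 1" and T: "k_branching k T"
  shows "card (block_level k T m) \<le> (2 ^ k - 1) ^ m"
proof (induction m)
  case 0
  have "block_level k T 0 \<subseteq> {[]}" by (auto simp: block_level_def)
  then show ?case using card_mono[of "{[]}" "block_level k T 0"] by simp
next
  case (Suc m)
  define R where "R \<tau> = {\<rho>. length \<rho> = k \<and>
    map (block_count k ((!) \<tau>)) [0..<m] @ [\<Sum>i<k. of_bool (\<rho> ! i)] \<in> T}" for \<tau>
  have fin: "finite {\<rho> :: bool list. length \<rho> = k}"
    and card: "card {\<rho> :: bool list. length \<rho> = k} = 2 ^ k"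
    using finite_lists_length_eq[of "UNIV :: bool set" k] card_lists_length_eq[of "UNIV :: bool set" k]
    by auto
  have R_sub: "R \<tau> \<subseteq> {\<rho>. length \<rho> = k}" for \<tau>
    by (auto simp: R_def)
  have R: "card (R \<tau>) \<le> 2 ^ k - 1" for \<tau>
  proof -
    obtain i where i: "i \<le> k" "map (block_count k ((!) \<tau>)) [0..<m] @ [i] \<notin> T"
      using k_branching_omits[OF assms] by blast
    \<comment> \<open>A block that realises the omitted count \<open>i\<close>: first
      \<open>i\<close> ones, then zeros.\<close>
    define \<rho> where "\<rho> = replicate i True @ replicate (k - i) False"
    have "(\<Sum>j<k. of_bool (\<rho> ! j)) = (\<Sum>j\<in>{..<k}. if j < i then 1 else 0 :: nat)"
      using i by (intro sum.cong) (auto simp: \<rho>_def nth_append)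
    also have "\<dots> = card ({..<k} \<inter> {j. j < i})"
      by (simp add: sum.If_cases)
    also have "{..<k} \<inter> {j. j < i} = {..<i}" using i by auto
    finally have "\<rho> \<notin> R \<tau>" using i by (simp add: R_def)
    moreover have "length \<rho> = k" using i by (simp add: \<rho>_def)
    ultimately have "R \<tau> \<subset> {\<rho>. length \<rho> = k}" using R_sub by blast
    from psubset_card_mono[OF fin this] card show ?thesis by simp
  qed
  have "block_level k T (Suc m) \<subseteq> (\<lambda>(\<tau>, \<rho>). \<tau> @ \<rho>) ` (SIGMA \<tau>:block_level k T m. R \<tau>)"
  proof
    fix \<sigma> assume "\<sigma> \<in> block_level k T (Suc m)"
    then have len: "length \<sigma> = k * m + k"
      and in_T: "map (block_count k ((!) \<sigma>)) [0..<m] @ [block_count k ((!) \<sigma>) m] \<in> T"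
      by (auto simp: block_level_def)
    have take: "map (block_count k ((!) (take (k * m) \<sigma>))) [0..<m] = map (block_count k ((!) \<sigma>)) [0..<m]"
      by (rule map_block_count_cong) simp
    have "map (block_count k ((!) \<sigma>)) [0..<m] \<in> T"
      using T in_T unfolding k_branching_def is_tree_def by (meson prefixI)
    then have "take (k * m) \<sigma> \<in> block_level k T m"
      by (simp add: block_level_def len take)
    moreover have "drop (k * m) \<sigma> \<in> R (take (k * m) \<sigma>)"
      using in_T len by (simp add: R_def take block_count_def del: sum_of_bool_eq)
    ultimately show "\<sigma> \<in> (\<lambda>(\<tau>, \<rho>). \<tau> @ \<rho>) ` (SIGMA \<tau>:block_level k T m. R \<tau>)"
      by (intro image_eqI[of _ _ "(take (k * m) \<sigma>, drop (k * m) \<sigma>)"]) auto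
  qed
  moreover have fin_Sigma: "finite (SIGMA \<tau>:block_level k T m. R \<tau>)"
    using finite_block_level finite_subset[OF R_sub fin] by blast
  ultimately have "card (block_level k T (Suc m)) \<le> card (SIGMA \<tau>:block_level k T m. R \<tau>)"
    by (rule surj_card_le[rotated])
  also have "\<dots> = (\<Sum>\<tau>\<in>block_level k T m. card (R \<tau>))"
    using finite_block_level finite_subset[OF R_sub fin] by simp
  also have "\<dots> \<le> card (block_level k T m) * (2 ^ k - 1)"
    using sum_bounded_above[of "block_level k T m" "\<lambda>\<tau>. card (R \<tau>)" "2 ^ k - 1"] R by simp
  also have "\<dots> \<le> (2 ^ k - 1) ^ m * (2 ^ k - 1)"
    by (rule mult_right_mono[OF Suc.IH]) simp
  finally show ?case by (simp add: mult.commute)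
qed

section \<open>Bit strings as binary digits of numbers\<close>

lemma bit_list_conv_horner_sum:
  fixes \<sigma> :: "bool list"
  shows "\<sigma> = map (bit (horner_sum of_bool 2 \<sigma> :: nat)) [0..<length \<sigma>]"
  by (rule nth_equalityI) (auto simp: bit_horner_sum_bit_iff)

lemma bij_betw_bits:
  "bij_betw (\<lambda>j::nat. map (bit j) [0..<n]) {..<2 ^ n} {\<sigma>. length \<sigma> = n}"
proof (rule bij_betw_byWitness[where f' = "horner_sum of_bool 2"])
  show "\<forall>j\<in>{..<2 ^ n}. horner_sum of_bool 2 (map (bit j) [0..<n]) = (j :: nat)"
    by (auto simp: horner_sum_bit_eq_take_bit take_bit_nat_eq_self)
  show "\<forall>\<sigma>\<in>{\<sigma>. length \<sigma> = n}. map (bit (horner_sum of_bool 2 \<sigma> :: nat)) [0..<n] = \<sigma>"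
    using bit_list_conv_horner_sum by auto
  show "horner_sum of_bool 2 ` {\<sigma>. length \<sigma> = n} \<subseteq> {..<2 ^ n :: nat}"
  proof clarify
    fix \<sigma> :: "bool list" assume "n = length \<sigma>"
    show "horner_sum of_bool 2 \<sigma> < (2 ^ length \<sigma> :: nat)"
      by (induction \<sigma>) auto
  qed
qed auto

lemma bits_in_block_level:
  "map (bit j) [0..<k * m] \<in> block_level k T m \<longleftrightarrow> map (block_count k (bit j)) [0..<m] \<in> T"
proof -
  have "map (block_count k ((!) (map (bit j) [0..<k * m]))) [0..<m] = map (block_count k (bit j)) [0..<m]"
    by (rule map_block_count_cong) simp
  then show ?thesis by (simp add: block_level_def del: map_eq_conv)
qed

text \<open>Replacing strings by the numbers whose binary digits they are makes the cardinality a
  bounded sum over a decidable condition, which is computable if \<open>T\<close> is.\<close>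

lemma card_block_level:
  "card (block_level k T m) =
    (\<Sum>j<2 ^ (k * m) :: nat. of_bool (map (block_count k (bit j)) [0..<m] \<in> T))"
proof -
  have "bij_betw (\<lambda>j::nat. map (bit j) [0..<k * m])
      {j \<in> {..<2 ^ (k * m)}. map (block_count k (bit j)) [0..<m] \<in> T} (block_level k T m)"
  proof (rule bij_betw_imageI)
    show "inj_on (\<lambda>j::nat. map (bit j) [0..<k * m])
        {j \<in> {..<2 ^ (k * m)}. map (block_count k (bit j)) [0..<m] \<in> T}"
      by (rule inj_on_subset[OF bij_betw_imp_inj_on[OF bij_betw_bits]]) auto
    have "\<sigma> \<in> (\<lambda>j::nat. map (bit j) [0..<k * m]) ` {..<2 ^ (k * m)}"
      if "\<sigma> \<in> block_level k T m" for \<sigma>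
      using that bij_betw_imp_surj_on[OF bij_betw_bits[of "k * m"]] by (auto simp: block_level_def)
    then show "(\<lambda>j::nat. map (bit j) [0..<k * m]) `
        {j \<in> {..<2 ^ (k * m)}. map (block_count k (bit j)) [0..<m] \<in> T} = block_level k T m"
      using bits_in_block_level by fastforce
  qed
  then show ?thesis
    using bij_betw_same_card by (fastforce simp: sum.If_cases of_bool_def Int_def)
qed

section \<open>The Schnorr test of a computable branching tree\<close>

text \<open>The parameter \<open>xs ! 0\<close> lets one rule serve both for the digits of a varying
  number (\<open>X = bit\<close>) and for a fixed real that ignores it.\<close>

lemma computable_on_block_count:
  assumes "computable_on A 2 (\<lambda>xs. of_bool (X (xs ! 0) (xs ! 1)))"
  shows "computable_on A 2 (\<lambda>xs. block_count k (X (xs ! 0)) (xs ! 1))"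
  unfolding block_count_def
  by (rule computable_on_sum[where g = "\<lambda>i xs. of_bool (X (xs ! 0) (k * (xs ! 1) + i))"])
    (intro computable_on_compose2[where g = "\<lambda>a b. of_bool (X a b)", OF assms]
      computable_on_add computable_on_mult computable_on_base; simp)+

text \<open>The code of the node is computed and handed to the decision procedure for codes of
  nodes; injectivity of \<open>list_encode\<close> leads back to membership in
  \<open>T\<close>.\<close>

lemma computable_on_tree_bits:
  assumes "computable_tree T"
  shows "computable_on empty_oracle 2
    (\<lambda>xs. of_bool (map (block_count k (bit (xs ! 0))) [0..<c * xs ! 1] \<in> T))"
proof -
  have "computable_on empty_oracle 2
      (\<lambda>xs. list_encode (map (block_count k (bit (xs ! 0))) [0..<c * xs ! 1]))"
    by (intro computable_on_list_encode[where g = "\<lambda>j. block_count k (bit j)"]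
        computable_on_block_count[where X = bit] computable_on_bit computable_on_mult
        computable_on_base; simp)
  moreover have "computable_on empty_oracle (Suc 0) (\<lambda>xs. of_bool (xs ! 0 \<in> list_encode ` T))"
    using assms unfolding computable_tree_def computable_set_def computable_def
    by (subst computable_on_Suc_0_iff[where f = "\<lambda>x. of_bool (x \<in> list_encode ` T)"])
  ultimately have "computable_on empty_oracle 2 (\<lambda>xs. of_bool
      (list_encode (map (block_count k (bit (xs ! 0))) [0..<c * xs ! 1]) \<in> list_encode ` T))"
    by (rule computable_on_compose1[rotated])
  then show ?thesis
    by (simp add: inj_image_mem_iff inj_list_encode)
qed

lemma uniformly_ce_block_level:
  assumes "computable_tree T"
  shows "uniformly_ce (\<lambda>n. block_level k T (c * n))"
proof -
  \<comment> \<open>The search variable \<open>j = xs ! 0\<close> comes first. The value is 0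
    exactly if the digits of \<open>j\<close> pass the tree test at level \<open>c * xs ! 1\<close>
    and the first \<open>k * (c * xs ! 1)\<close> of them form the bit string coded by
    \<open>xs ! 2\<close>.\<close>
  define f :: "nat list \<Rightarrow> nat" where "f xs =
      1 - of_bool (map (block_count k (bit (xs ! 0))) [0..<c * xs ! 1] \<in> T) *
        of_bool (list_encode (map (\<lambda>i. of_bool (bit (xs ! 0) i)) [0..<k * (c * xs ! 1)]) = xs ! 2)"
    for xs :: "nat list"
  have "computable_on empty_oracle 3 f"
    unfolding f_def
    by (intro computable_on_diff computable_on_mult computable_on_eq computable_on_base
        computable_on_list_encode[where g = "\<lambda>j i. of_bool (bit j i)"] computable_on_bit
        computable_on_compose2[where g = "\<lambda>j n. of_bool (map (block_count k (bit j)) [0..<c * n] \<in> T)",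
          OF computable_on_tree_bits[OF assms]]; simp)
  then obtain p where p: "\<And>xs. length xs = 2 \<Longrightarrow>
      (\<exists>y. computes empty_oracle p xs y) \<longleftrightarrow> (\<exists>j. f (j # xs) = 0)"
    using computable_on_Mu[of empty_oracle 2 f] by (auto simp: numeral_3_eq_3)
  have "\<sigma> \<in> block_level k T (c * n) \<longleftrightarrow> (\<exists>j. f [j, n, list_encode (map of_bool \<sigma>)] = 0)" for n \<sigma>
  proof -
    have enc: "list_encode (map (\<lambda>i. of_bool (bit j i)) [0..<m]) = list_encode (map of_bool \<sigma>)
        \<longleftrightarrow> \<sigma> = map (bit j) [0..<m]" for j m :: nat
    proof -
      have "map (\<lambda>i. of_bool (bit j i) :: nat) [0..<m] = map of_bool (map (bit j) [0..<m])"
        by simp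
      moreover have "inj (of_bool :: bool \<Rightarrow> nat)" by (auto simp: inj_def)
      ultimately show ?thesis
        using inj_map_eq_map inj_eq[OF inj_list_encode] by metis
    qed
    have "(\<exists>j. f [j, n, list_encode (map of_bool \<sigma>)] = 0) \<longleftrightarrow>
        (\<exists>j::nat. \<sigma> = map (bit j) [0..<k * (c * n)] \<and> map (block_count k (bit j)) [0..<c * n] \<in> T)"
      by (auto simp: f_def enc)
    also have "\<dots> \<longleftrightarrow> (\<exists>j::nat. \<sigma> = map (bit j) [0..<k * (c * n)]) \<and> \<sigma> \<in> block_level k T (c * n)"
      using bits_in_block_level by metis
    also have "\<dots> \<longleftrightarrow> \<sigma> \<in> block_level k T (c * n)"
      using bit_list_conv_horner_sum[of \<sigma>] by (auto simp: block_level_def)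
    finally show ?thesis ..
  qed
  then show ?thesis
    unfolding uniformly_ce_def using p by (metis length_Cons list.size(3) numeral_2_eq_2)
qed

lemma schnorr_test_block_level:
  assumes "k \<ge> 1" "k_branching k T" "computable_tree T"
  obtains c where "schnorr_test (\<lambda>n. open_of (block_level k T (c * n)))"
proof -
  have "(\<lambda>n. (1 - 1 / 2 ^ k :: real) ^ n) \<longlonglongrightarrow> 0"
    by (rule LIMSEQ_realpow_zero) auto
  then have "eventually (\<lambda>n. (1 - 1 / 2 ^ k :: real) ^ n < 1 / 2) sequentially"
    by (rule order_tendstoD) simp
  \<comment> \<open>Climbing \<open>c\<close> levels shrinks the measure bound by a factor below
    1/2, so level \<open>c * n\<close> meets the bound required of the \<open>n\<close>-th test
    component.\<close>
  then obtain c where c: "(1 - 1 / 2 ^ k :: real) ^ c < 1 / 2"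
    by (auto simp: eventually_sequentially)
  have measure: "measure cantor_measure (open_of (block_level k T m))
      = real (card (block_level k T m)) / 2 ^ (k * m)" for m
    by (rule measure_open_of) (auto simp: block_level_def)
  have "measure cantor_measure (open_of (block_level k T (c * n))) \<le> 1 / 2 ^ n" for n
  proof -
    have "measure cantor_measure (open_of (block_level k T (c * n)))
        \<le> real ((2 ^ k - 1) ^ (c * n)) / 2 ^ (k * (c * n))"
      unfolding measure using card_block_level_le[OF assms(1,2)]
      by (intro divide_right_mono of_nat_mono) auto
    also have "\<dots> = ((1 - 1 / 2 ^ k) ^ c) ^ n"
      by (simp add: power_mult power_divide[symmetric] of_nat_diff diff_divide_distrib)
    also have "\<dots> \<le> (1 / 2) ^ n"
      using c by (intro power_mono) auto
    finally show ?thesis by (simp add: power_one_over)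
  qed
  moreover have "uniformly_computable_reals
      (\<lambda>n. measure cantor_measure (open_of (block_level k T (c * n))))"
  proof -
    have "computable2 (\<lambda>n i. card (block_level k T (c * n)))"
      unfolding card_block_level
      by (intro computable2I computable_on_power computable_on_mult computable_on_base computable_on_sum
          [where g = "\<lambda>j xs. of_bool (map (block_count k (bit j)) [0..<c * xs ! 0] \<in> T)"]
          computable_on_compose2[where g = "\<lambda>j n. of_bool (map (block_count k (bit j)) [0..<c * n] \<in> T)",
            OF computable_on_tree_bits[OF assms(3)]]; simp)
    moreover have "computable2 (\<lambda>n i. 0)"
      by (intro computable2I computable_on_base)
    \<comment> \<open>The measure is itself a computable fraction, so the same numbers serve for
      every precision \<open>i\<close>. The subtraction of 1 offsets the denominator
      \<open>c n i + 1\<close> in the definition of computable reals.\<close>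
    moreover have "computable2 (\<lambda>n i. 2 ^ (k * (c * n)) - 1)"
      by (intro computable2I computable_on_diff computable_on_power computable_on_mult
          computable_on_base) auto
    ultimately show ?thesis
      unfolding uniformly_computable_reals_def measure
      by (intro exI conjI) (assumption+, simp add: of_nat_diff)
  qed
  ultimately have "schnorr_test (\<lambda>n. open_of (block_level k T (c * n)))"
    unfolding schnorr_test_def using uniformly_ce_block_level[OF assms(3)] by blast
  with that show ?thesis .
qed

lemma surviving_fun_block_count:
  assumes "k \<ge> 1" "schnorr_random X"
  shows "surviving_fun k (block_count k X)"
  unfolding surviving_fun_def
proof (intro conjI allI notI)
  show "block_count k X n < k + 1" for n
    using block_count_le[of k X n] by simp
  assume "\<exists>T. k_branching k T \<and> computable_tree T \<and> is_path (block_count k X) T"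
  then obtain T where T: "k_branching k T" "computable_tree T" and path: "is_path (block_count k X) T"
    by blast
  obtain c where test: "schnorr_test (\<lambda>n. open_of (block_level k T (c * n)))"
    using schnorr_test_block_level[OF assms(1) T] .
  \<comment> \<open>If the counts of \<open>X\<close> follow a path of \<open>T\<close>, then the
    first \<open>k * m\<close> bits of \<open>X\<close> belong to every level \<open>m\<close>, and
    \<open>X\<close> fails the test.\<close>
  have "X \<in> open_of (block_level k T m)" for m
  proof -
    let ?\<sigma> = "map X [0..<k * m]"
    have "map (block_count k ((!) ?\<sigma>)) [0..<m] = map (block_count k X) [0..<m]"
      by (rule map_block_count_cong) simp
    then have "?\<sigma> \<in> block_level k T m"
      using path by (simp add: block_level_def is_path_def del: map_eq_conv)
    moreover have "X \<in> cylinder ?\<sigma>" by (simp add: cylinder_def)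
    ultimately show ?thesis unfolding open_of_def by blast
  qed
  with test assms(2) show False unfolding schnorr_random_def by blast
qed

lemma schnorr_random_surviving:
  assumes "k \<ge> 1" "schnorr_random X" "deg_computes_real a X"
  shows "surviving k a"
proof -
  obtain A where a: "a = abs_turing_degree A"
    using Quotient3_abs_rep[OF Quotient3_turing_degree] by metis
  have "computable_on A (Suc 0) (\<lambda>xs. of_bool (X (xs ! 0)))"
    using assms(3) unfolding deg_computes_real_def a deg_computes.abs_eq
    by (subst computable_on_Suc_0_iff[where f = "\<lambda>x. of_bool (X x)"])
  \<comment> \<open>A dummy first argument is added to fit the parametrised rule for block counts;
    afterwards it is filled with 0.\<close>
  then have "computable_on A 2 (\<lambda>xs. of_bool (X (xs ! 1)))"
    by (rule computable_on_compose1) (simp add: computable_on_nth)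
  then have "computable_on A 2 (\<lambda>xs. block_count k X (xs ! 1))"
    by (rule computable_on_block_count)
  then have "computable_on A (Suc 0) (\<lambda>xs. block_count k X (xs ! 0))"
    by (rule computable_on_compose2[where f = "\<lambda>xs. 0" and g = "\<lambda>_. block_count k X"])
      (auto intro: computable_on_base)
  then have "deg_computes a (block_count k X)"
    unfolding a deg_computes.abs_eq by (subst (asm) computable_on_Suc_0_iff)
  with surviving_fun_block_count[OF assms(1,2)] show ?thesis
    unfolding surviving_def by blast
qed

section \<open>Diagonalisation\<close>

text \<open>The oracle codes the graphs of all \<open>h b\<close> together. The value
  \<open>h b n\<close> is found by searching for the \<open>y\<close> with \<open>(b, n, y)\<close>
  in the oracle, and totality of \<open>h b\<close> ends the search.\<close>

lemma ex_deg_computes_all: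
  fixes h :: "nat \<Rightarrow> nat \<Rightarrow> nat"
  shows "\<exists>a. \<forall>b. deg_computes a (h b)"
proof -
  define A where "A x \<longleftrightarrow> (case prod_decode x of (b, z) \<Rightarrow> case prod_decode z of (n, y) \<Rightarrow> h b n = y)"
    for x
  have "computable_from A (h b)" for b
  proof -
    define f where "f xs = 1 - (of_bool (A (prod_encode (b, prod_encode (xs ! 1, xs ! 0)))) :: nat)"
      for xs
    have "computable_on A 2 f"
      unfolding f_def
      by (intro computable_on_diff computable_on_oracle computable_on_prod_encode computable_on_base) auto
    then obtain p where "\<And>ys. length ys = Suc 1 \<Longrightarrow> computes A p ys (f ys)"
      by (auto simp: computable_on_def numeral_2_eq_2)
    from computes_Mu[OF this] have "computes A (Mu p) [n] (h b n)" for n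
      by (auto simp: f_def A_def)
    then show ?thesis unfolding computable_from_def by blast
  qed
  then have "\<forall>b. deg_computes (abs_turing_degree A) (h b)"
    by (simp add: deg_computes.abs_eq)
  then show ?thesis by blast
qed

lemma ex_deg_computes_both: "\<exists>a. deg_computes a f \<and> deg_computes a g"
proof -
  obtain a where a: "\<And>b. deg_computes a (case b of 0 \<Rightarrow> f | Suc _ \<Rightarrow> g)"
    using ex_deg_computes_all[of "\<lambda>b. case b of 0 \<Rightarrow> f | Suc _ \<Rightarrow> g"] by blast
  show ?thesis using a[of 0] a[of 1] by auto
qed

section \<open>Escaping all computable functions\<close>

text \<open>A code determines its program, and a program determines the total function it computes.
  The enumeration is by choice: at numbers that code no program for a total function its value is
  arbitrary.\<close>

lemma ex_enumeration_computable:
  "\<exists>e :: nat \<Rightarrow> nat \<Rightarrow> nat. \<forall>f. computable f \<longrightarrow> f \<in> range e"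
proof (intro exI allI impI)
  fix f
  let ?P = "\<lambda>i f. \<exists>p. program_encode p = i \<and> (\<forall>x. computes empty_oracle p [x] (f x))"
  assume "computable f"
  then obtain p where p: "\<And>x. computes empty_oracle p [x] (f x)"
    by (auto simp: computable_def computable_from_def)
  have "(SOME f. ?P (program_encode p) f) = f"
  proof (rule some_equality)
    show "?P (program_encode p) f" using p by blast
    fix g assume "?P (program_encode p) g"
    then have "\<And>x. computes empty_oracle p [x] (g x)" by (metis program_encode_inject)
    with p show "g = f" by (meson computes_deterministic ext)
  qed
  then show "f \<in> range (\<lambda>i. SOME f. ?P i f)" by (rule range_eqI[OF sym])
qed

text \<open>The value at \<open>n\<close> is chosen so that the path leaves the \<open>n\<close>-th
  candidate tree there, using the successor that a branching tree omits.\<close>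

lemma ex_surviving_fun:
  assumes "k \<ge> 1"
  shows "\<exists>f. surviving_fun k f"
proof -
  obtain e :: "nat \<Rightarrow> nat \<Rightarrow> nat" where e: "\<And>f. computable f \<Longrightarrow> f \<in> range e"
    using ex_enumeration_computable by blast
  \<comment> \<open>Reading each \<open>e n\<close> as a characteristic function on codes lists all
    computable trees, among other sets; \<open>pick\<close> is constrained only where
    \<open>T n\<close> is branching.\<close>
  define T where "T n = {\<sigma>. e n (list_encode \<sigma>) = 1}" for n
  have "\<exists>i\<le>k. k_branching k (T n) \<longrightarrow> \<sigma> @ [i] \<notin> T n" for n \<sigma>
    using k_branching_omits[OF assms] by blast
  then obtain pick where pick_le: "\<And>n \<sigma>. pick n \<sigma> \<le> k"
    and pick: "\<And>n \<sigma>. k_branching k (T n) \<Longrightarrow> \<sigma> @ [pick n \<sigma>] \<notin> T n"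
    by metis
  \<comment> \<open>\<open>w n\<close> is the initial segment of length \<open>n\<close> of the
    function under construction, whose next value depends on it.\<close>
  define w where "w = rec_nat [] (\<lambda>n \<sigma>. \<sigma> @ [pick n \<sigma>])"
  have w: "w n = map (\<lambda>n. pick n (w n)) [0..<n]" for n
    by (induction n) (auto simp: w_def)
  have "surviving_fun k (\<lambda>n. pick n (w n))"
    unfolding surviving_fun_def
  proof (intro conjI allI notI)
    show "pick n (w n) < k + 1" for n using pick_le[of n "w n"] by simp
    assume "\<exists>S. k_branching k S \<and> computable_tree S \<and> is_path (\<lambda>n. pick n (w n)) S"
    then obtain S where S: "k_branching k S" "computable_tree S" "is_path (\<lambda>n. pick n (w n)) S"
      by blast
    then obtain n where n: "(\<lambda>x. of_bool (x \<in> list_encode ` S)) = e n"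
      using e unfolding computable_tree_def computable_set_def by blast
    have "T n = S"
      unfolding T_def n[symmetric] by (auto simp: inj_image_mem_iff inj_list_encode)
    moreover have "w (Suc n) = w n @ [pick n (w n)]" by (simp add: w_def)
    ultimately show False
      using S pick[of n "w n"] w[of "Suc n"] unfolding is_path_def by metis
  qed
  then show ?thesis by blast
qed

text \<open>The value 1 avoids the output 0, and 0 avoids every other output; the two cases cannot
  collide because \<open>\<phi> e e\<close> has at most one output.\<close>

lemma ex_DNC_fun: "\<exists>g. \<forall>e y. \<phi> e e y \<longrightarrow> g e \<noteq> y"
proof -
  have "\<phi> e e y \<Longrightarrow> \<phi> e e z \<Longrightarrow> y = z" for e y z
    unfolding phi_def using program_encode_inject computes_deterministic by blast
  then have "\<forall>e y. \<phi> e e y \<longrightarrow> (if \<phi> e e 0 then 1 else 0) \<noteq> y"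
    by (metis zero_neq_one)
  then show ?thesis by (rule exI[where x = "\<lambda>e. if \<phi> e e 0 then 1 else 0"])
qed

text \<open>At \<open>n\<close> the value is chosen outside the finite set that the
  \<open>n\<close>-th computable sequence offers there. Sets of every finite size are escaped, so no
  bound \<open>h\<close> admits a trace of \<open>g\<close>.\<close>

lemma ex_untraceable_fun: "\<exists>g. \<forall>d. computable d \<longrightarrow> (\<exists>n. g n \<notin> set_decode (d n))"
proof -
  obtain e :: "nat \<Rightarrow> nat \<Rightarrow> nat" where e: "\<And>f. computable f \<Longrightarrow> f \<in> range e"
    using ex_enumeration_computable by blast
  have "\<exists>y. y \<notin> set_decode (e n n)" for n
    using ex_new_if_finite[OF infinite_UNIV_nat finite_set_decode] .
  then obtain g where "\<And>n. g n \<notin> set_decode (e n n)" by metis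
  with e show ?thesis by blast
qed

theorem theorem2p6:
  "(\<forall>k\<ge>2. \<forall>a. (\<exists>X. schnorr_random X \<and> deg_computes_real a X) \<longrightarrow> surviving k a) \<and>
   (\<forall>k\<ge>2. \<exists>a. surviving k a \<and> DNC a) \<and>
   (\<forall>k\<ge>2. \<exists>a. surviving k a \<and> \<not> computably_traceable a)"
proof (intro conjI allI impI)
  fix k :: nat
  assume "k \<ge> 2"
  then have k: "k \<ge> 1" by simp
  show "surviving k a" if "\<exists>X. schnorr_random X \<and> deg_computes_real a X" for a
    using that schnorr_random_surviving[OF k] by blast
  \<comment> \<open>For both existence claims the degree computes this \<open>f\<close> together
    with a second function that witnesses the other property.\<close>
  obtain f where f: "surviving_fun k f"
    using ex_surviving_fun[OF k] by blast
  show "\<exists>a. surviving k a \<and> DNC a"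
    using ex_DNC_fun ex_deg_computes_both[of f] f unfolding surviving_def DNC_def by metis
  show "\<exists>a. surviving k a \<and> \<not> computably_traceable a"
    using ex_untraceable_fun ex_deg_computes_both[of f] f
    unfolding surviving_def computably_traceable_def by metis
qed

end
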